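(* Let $n$ and $s$ be integers for which $t=(n-3s+1)/2$ is a positive integer and $n\le 7s/2-1$, and let $T\subseteq[0,2t-1]$ be a nonempty set of integers. Then the set $S_T\subseteq\mathbb{Z}_n$ is complete if and only if \[[0,2t-1+\min(T)]\setminus(2t-1-T)\subseteq T+T,\] where the addition in this condition is over the integers.
   Context: $\mathbb{Z}_n$ is the cyclic group of integers modulo $n$. For subsets $A,B$ of an abelian additive group $G$, $A+B=\{x+y \mid x\in A, y\in B\}$, $-A=\{-x \mid x\in A\}$, and $\pm A=A\cup(-A)$. A set $S\subseteq G$ is complete if every $z\in G\setminus S$ satisfies $z\in S+S$. For integers $a\le b$, $[a,b]=\{z\in\mathbb{Z} \mid a\le z\le b\}$; the same notation is used for the subset of $\mathbb{Z}_n$ represented by these integers. $\min(T)$ is the smallest integer in $T$, and $2t-1-T=\{2t-1-x \mid x\in T\}$. Definition of $S_T$: for integers $n,s$ such that $t=(n-3s+1)/2$ is a positive integer and $n\le 4s-3$ (this last inequality follows from the hypotheses of the claim), and a set of integers $T\subseteq[0,2t-1]$, $S_T\subseteq\mathbb{Z}_n$ is the set $S_T=[n-2s+1,2s-1]\cup\pm(s+T)$ (taken modulo $n$), where $s+T=\{s+x \mid x\in T\}$. *)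

theory Defs
  imports Complex_Main "HOL-Algebra.Elementary_Groups" "HOL-Library.Set_Algebras"
begin

(* HOL-Algebra groups are written multiplicatively, so for an additive group G the sumset A + B is
   A <#>\<^bsub>G\<^esub> B and -A is set_inv\<^bsub>G\<^esub> A. *)

definition plus_minus :: "('a, 'b) monoid_scheme \<Rightarrow> 'a set \<Rightarrow> 'a set" where
  "plus_minus G A = A \<union> set_inv\<^bsub>G\<^esub> A"

definition complete_in :: "('a, 'b) monoid_scheme \<Rightarrow> 'a set \<Rightarrow> bool" where
  "complete_in G S \<longleftrightarrow> S \<subseteq> carrier G \<and> (\<forall>z \<in> carrier G - S. z \<in> S <#>\<^bsub>G\<^esub> S)"

(* The cyclic group of integers modulo n, for n > 0.  Its carrier is {0..<n}; for n \<le> 0 the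
   truncation in nat would give the infinite cyclic group, a case that does not arise below. *)
abbreviation Zmod :: "int \<Rightarrow> int monoid" where
  "Zmod n \<equiv> integer_mod_group (nat n)"

definition residues_of :: "int \<Rightarrow> int set \<Rightarrow> int set" where
  "residues_of n A = (\<lambda>x. x mod n) ` A"

definition S_set :: "int \<Rightarrow> int \<Rightarrow> int set \<Rightarrow> int set" where
  "S_set n s T = residues_of n {n - 2 * s + 1..2 * s - 1}
     \<union> plus_minus (Zmod n) (residues_of n ((\<lambda>x. s + x) ` T))"

end

theory Submission
  imports Defs
begin

text \<open>
  Since \<open>n = 3 s + 2 t - 1\<close>, the canonical representatives of \<open>S_T\<close> lie in
  \<open>[s, 2 s + 2 t - 1]\<close>: there is the block \<open>[s + 2 t, 2 s - 1]\<close>, to its left the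
  set \<open>s + T\<close>, and to its right the reflection of \<open>s + T\<close> under \<open>x \<mapsto> n - x\<close>.
  The bound on \<open>n\<close> says exactly \<open>4 t \<le> s\<close>, so the block is long.

  The set is invariant under this reflection, hence so are its sumset and its complement,
  and only the residues \<open>z \<le> s + 2 t - 1\<close> have to be examined. Write \<open>m\<close> for \<open>min T\<close>.
  If \<open>z < s - m\<close>, then \<open>z\<close> is always a sum, of two elements of the block or of one
  element of the block and the largest element \<open>2 s + 2 t - 1 - m\<close> of \<open>S_T\<close>
  (\<open>small_residue_is_sum\<close>). If \<open>z \<ge> s - m\<close>, two elements of \<open>S_T\<close> can only add up to
  \<open>z\<close> by wrapping around \<open>n\<close>, and \<open>z + n\<close> is so large that both must
  lie in the rightmost part. They are \<open>2 s + 2 t - 1 - x\<close> and \<open>2 s + 2 t - 1 - y\<close> with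
  \<open>x, y \<in> T\<close>, and the sum condition becomes \<open>s + 2 t - 1 - z = x + y\<close>
  (\<open>border_residue_is_sum_iff\<close>). The substitution \<open>w = s + 2 t - 1 - z\<close> turns
  \<open>[s - m, s + 2 t - 1]\<close> into \<open>[0, 2 t - 1 + m]\<close> and \<open>s + T\<close> into
  \<open>2 t - 1 - T\<close>, which is the stated condition.
\<close>

text \<open>
  The last part is \<open>n - (s + T)\<close>. With \<open>n\<close> expressed by \<open>s\<close> and \<open>t\<close>, the
  three parts are integer sets and linear arithmetic decides all comparisons between them.
\<close>
definition S_reps :: "int \<Rightarrow> int \<Rightarrow> int set \<Rightarrow> int set" where
  "S_reps s t T = {s + 2 * t..2 * s - 1} \<union> (\<lambda>x. s + x) ` T \<union> (\<lambda>x. 2 * s + 2 * t - 1 - x) ` T"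

lemma S_repsE:
  assumes "c \<in> S_reps s t T"
  obtains (block) "s + 2 * t \<le> c" "c \<le> 2 * s - 1"
    | (left) x where "x \<in> T" "c = s + x"
    | (right) x where "x \<in> T" "c = 2 * s + 2 * t - 1 - x"
  using assms by (auto simp: S_reps_def)

lemma Zmod_carrier: "0 < n \<Longrightarrow> carrier (Zmod n) = {0..<n}"
  by (simp add: carrier_integer_mod_group)

lemma Zmod_set_mult_iff:
  assumes "0 < n"
  shows "z \<in> A <#>\<^bsub>Zmod n\<^esub> B \<longleftrightarrow> (\<exists>a\<in>A. \<exists>b\<in>B. z = (a + b) mod n)"
  using assms by (auto simp: set_mult_def)

lemma set_inv_residues_of:
  assumes "0 < n"
  shows "set_inv\<^bsub>Zmod n\<^esub> (residues_of n A) = residues_of n (uminus ` A)"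
proof -
  have "inv\<^bsub>Zmod n\<^esub> (x mod n) = (- x) mod n" for x
    using assms by (simp add: inv_integer_mod_group Zmod_carrier mod_minus_eq)
  then show ?thesis
    by (auto simp: SET_INV_def residues_of_def)
qed

lemma residues_of_Un: "residues_of n (A \<union> B) = residues_of n A \<union> residues_of n B"
  by (auto simp: residues_of_def)

lemma residues_of_add: "residues_of n ((\<lambda>x. x + n) ` A) = residues_of n A"
  by (auto simp: residues_of_def image_image)

lemma residues_of_ident: "A \<subseteq> {0..<n} \<Longrightarrow> residues_of n A = A"
  by (force simp: residues_of_def image_iff)

lemma S_reps_bounds:
  assumes "4 * t \<le> s" "0 < t" "T \<subseteq> {0..2 * t - 1}"
  shows "S_reps s t T \<subseteq> {s..2 * s + 2 * t - 1}"
  using assms by (auto simp: S_reps_def)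

lemma S_set_eq_S_reps:
  assumes "n = 3 * s + 2 * t - 1" "4 * t \<le> s" "0 < t" "T \<subseteq> {0..2 * t - 1}"
  shows "S_set n s T = S_reps s t T"
proof -
  have "0 < n" and "S_reps s t T \<subseteq> {0..<n}"
    using assms S_reps_bounds[of t s T] by auto
  have "(\<lambda>x. x + n) ` uminus ` (\<lambda>x. s + x) ` T = (\<lambda>x. 2 * s + 2 * t - 1 - x) ` T"
    unfolding image_image by (rule image_cong) (simp_all add: assms(1))
  then have "residues_of n (uminus ` (\<lambda>x. s + x) ` T)
      = residues_of n ((\<lambda>x. 2 * s + 2 * t - 1 - x) ` T)"
    by (metis residues_of_add)
  then have "S_set n s T = residues_of n (S_reps s t T)"
    using \<open>0 < n\<close> assms(1)
    by (simp add: S_set_def plus_minus_def set_inv_residues_of S_reps_def residues_of_Un Un_assoc)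
  then show ?thesis
    using \<open>S_reps s t T \<subseteq> {0..<n}\<close> by (simp add: residues_of_ident)
qed

lemma S_reps_reflect:
  assumes "n = 3 * s + 2 * t - 1" "x \<in> S_reps s t T"
  shows "n - x \<in> S_reps s t T"
  using assms(2)
proof (cases rule: S_repsE)
  case block
  then show ?thesis using assms(1) by (simp add: S_reps_def)
next
  case (left u)
  then have "n - x = 2 * s + 2 * t - 1 - u" using assms(1) by simp
  with left(1) show ?thesis unfolding S_reps_def by blast
next
  case (right u)
  then have "n - x = s + u" using assms(1) by simp
  with right(1) show ?thesis unfolding S_reps_def by blast
qed

lemma S_reps_sum_reflect:
  assumes "n = 3 * s + 2 * t - 1" "0 < n" "0 < z" "z < n"
    and "n - z \<in> S_reps s t T <#>\<^bsub>Zmod n\<^esub> S_reps s t T"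
  shows "z \<in> S_reps s t T <#>\<^bsub>Zmod n\<^esub> S_reps s t T"
proof -
  obtain a b where ab: "a \<in> S_reps s t T" "b \<in> S_reps s t T" "n - z = (a + b) mod n"
    using assms(2,5) by (auto simp: Zmod_set_mult_iff)
  have "((n - a) + (n - b)) mod n = (- (a + b)) mod n"
    by (simp add: mod_eq_dvd_iff)
  also have "\<dots> = (- (n - z)) mod n"
    unfolding ab(3) by (simp add: mod_minus_eq)
  also have "\<dots> = z"
    using assms(3,4) by simp
  finally show ?thesis
    using ab(1,2) S_reps_reflect[OF assms(1)] \<open>0 < n\<close> by (metis Zmod_set_mult_iff)
qed

text \<open>
  The block is an interval of at least \<open>2 t\<close> elements, so its translate by the element
  \<open>2 s + 2 t - 1 - m\<close> of \<open>S_T\<close>, which is the interval \<open>[2 t - m, s - 1 - m]\<close> modulo \<open>n\<close>,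
  leaves no gap after the sums of two elements of the block, which end at \<open>s - 2 t - 1\<close>.
\<close>
lemma small_residue_is_sum:
  assumes n: "n = 3 * s + 2 * t - 1" and st: "4 * t \<le> s" "0 < t"
    and m: "m \<in> T" "0 \<le> m" "m < 2 * t" and z: "0 \<le> z" "z < s - m"
  shows "z \<in> S_reps s t T <#>\<^bsub>Zmod n\<^esub> S_reps s t T"
proof -
  have "\<exists>a\<in>S_reps s t T. \<exists>b\<in>S_reps s t T. a + b = z + n"
  proof (cases "z < s - 2 * t")
    case True
    then have "2 * s - 1 \<in> S_reps s t T" "s + 2 * t + z \<in> S_reps s t T"
      using st z by (auto simp: S_reps_def)
    then show ?thesis
      using n by (intro bexI[of _ "2 * s - 1"] bexI[of _ "s + 2 * t + z"]) auto
  next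
    case False
    then have "2 * s + 2 * t - 1 - m \<in> S_reps s t T" "s + m + z \<in> S_reps s t T"
      using st z m by (auto simp: S_reps_def)
    then show ?thesis
      using n by (intro bexI[of _ "2 * s + 2 * t - 1 - m"] bexI[of _ "s + m + z"]) auto
  qed
  then obtain a b where ab: "a \<in> S_reps s t T" "b \<in> S_reps s t T" "a + b = z + n"
    by auto
  have "z < n" "0 < n" using n st z m by linarith+
  then have "z = (a + b) mod n"
    using ab(3) z(1) by simp
  then show ?thesis
    using ab(1,2) \<open>0 < n\<close> by (metis Zmod_set_mult_iff)
qed

text \<open>
  Here the sum must wrap around exactly once, because \<open>2 s\<close> is a lower bound for the sum of
  two representatives and exceeds \<open>z\<close>. An element that is at most \<open>2 s - 1\<close> is too small to be
  a summand, since no representative exceeds \<open>2 s + 2 t - 1 - m\<close>.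
\<close>
lemma border_residue_is_sum_iff:
  assumes n: "n = 3 * s + 2 * t - 1" and st: "4 * t \<le> s" "0 < t"
    and T: "T \<subseteq> {m..2 * t - 1}" "0 \<le> m" "m < 2 * t" and z: "s - m \<le> z" "z < s + 2 * t"
  shows "z \<in> S_reps s t T <#>\<^bsub>Zmod n\<^esub> S_reps s t T \<longleftrightarrow> s + 2 * t - 1 - z \<in> T + T"
    (is "?sum \<longleftrightarrow> ?diff")
proof
  have "0 < n" using n st by simp
  {
    assume ?sum
    then obtain a b where ab: "a \<in> S_reps s t T" "b \<in> S_reps s t T" "z = (a + b) mod n"
      using \<open>0 < n\<close> by (auto simp: Zmod_set_mult_iff)
    have bounds: "s \<le> c \<and> c \<le> 2 * s + 2 * t - 1 - m" if "c \<in> S_reps s t T" for c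
      using that
    proof (cases rule: S_repsE)
      case (left x)
      then have "x \<in> {m..2 * t - 1}" using T(1) by blast
      then show ?thesis using left st T(2,3) by simp
    next
      case (right x)
      then have "x \<in> {m..2 * t - 1}" using T(1) by blast
      then show ?thesis using right st T(2,3) by simp
    qed (use st T(2,3) in auto)
    have "2 * s \<le> a + b" "a + b < 2 * n"
      using bounds[OF ab(1)] bounds[OF ab(2)] n st T(2) by linarith+
    have "n \<le> a + b"
    proof (rule ccontr)
      assume "\<not> n \<le> a + b"
      then have "z = a + b"
        using ab(3) \<open>2 * s \<le> a + b\<close> st by simp
      then show False
        using z(2) \<open>2 * s \<le> a + b\<close> st by simp
    qed
    have "(a + b) mod n = (a + b - n) mod n"
      by simp
    also have "\<dots> = a + b - n"
      using \<open>n \<le> a + b\<close> \<open>a + b < 2 * n\<close> by (intro mod_pos_pos_trivial) auto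
    finally have sum: "a + b = z + n"
      using ab(3) by simp
    have large: "\<exists>x\<in>T. c = 2 * s + 2 * t - 1 - x"
      if "c \<in> S_reps s t T" "d \<in> S_reps s t T" "c + d = z + n" for c d
    proof -
      have "2 * s - 1 < c"
        using that(3) bounds[OF that(2)] z(1) n by linarith
      from that(1) show ?thesis
      proof (cases rule: S_repsE)
        case (left x)
        then have "x \<in> {m..2 * t - 1}" using T(1) by blast
        then show ?thesis using left st \<open>2 * s - 1 < c\<close> by simp
      qed (use \<open>2 * s - 1 < c\<close> in auto)
    qed
    obtain x where x: "x \<in> T" "a = 2 * s + 2 * t - 1 - x"
      using large[OF ab(1,2) sum] by auto
    obtain y where y: "y \<in> T" "b = 2 * s + 2 * t - 1 - y"
      using large[OF ab(2,1)] sum by (auto simp: add.commute)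
    have "s + 2 * t - 1 - z = x + y"
      using sum x(2) y(2) n by simp
    then show ?diff
      using x(1) y(1) by (auto simp: set_plus_def)
  }
  {
    assume ?diff
    then obtain x y where xy: "x \<in> T" "y \<in> T" "s + 2 * t - 1 - z = x + y"
      by (auto simp: set_plus_def)
    let ?a = "2 * s + 2 * t - 1 - x" and ?b = "2 * s + 2 * t - 1 - y"
    have "m \<le> x" "x \<le> 2 * t - 1" using xy(1) T by auto
    then have "0 \<le> z" "z < n" using z st n by linarith+
    moreover have "?a + ?b = z + n" using xy(3) n by simp
    ultimately have "z = (?a + ?b) mod n" by simp
    moreover have "?a \<in> S_reps s t T" "?b \<in> S_reps s t T"
      using xy(1,2) by (auto simp: S_reps_def)
    ultimately show ?sum
      using \<open>0 < n\<close> by (metis Zmod_set_mult_iff)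
  }
qed

theorem lemma3p3:
  fixes n s t :: int and T :: "int set"
  assumes "real_of_int t = (real_of_int n - 3 * real_of_int s + 1) / 2"
    and "t > 0"
    and "real_of_int n \<le> 7 * real_of_int s / 2 - 1"
    and "T \<subseteq> {0..2 * t - 1}"
    and "T \<noteq> {}"
  shows "complete_in (Zmod n) (S_set n s T) \<longleftrightarrow>
    {0..2 * t - 1 + Min T} - (\<lambda>x. 2 * t - 1 - x) ` T \<subseteq> T + T"
proof -
  have "real_of_int n = real_of_int (3 * s + 2 * t - 1)"
    using assms(1) by simp
  then have n: "n = 3 * s + 2 * t - 1"
    by linarith
  have "real_of_int (4 * t) \<le> real_of_int s"
    using assms(3) unfolding n by simp
  then have st: "4 * t \<le> s" "0 < t"
    using assms(2) by linarith+
  have "0 < n" using n st by simp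
  define m where "m = Min T"
  define S where "S = S_reps s t T"
  have "finite T"
    using assms(4) finite_subset by blast
  then have "m \<in> T" and T: "T \<subseteq> {m..2 * t - 1}"
    using assms(4,5) by (auto simp: m_def)
  then have m: "0 \<le> m" "m < 2 * t"
    using assms(4) by force+
  have S_range: "S \<subseteq> {s..2 * s + 2 * t - 1}"
    unfolding S_def using S_reps_bounds st assms(4) by blast
  have left: "z \<in> S \<longleftrightarrow> s + 2 * t - 1 - z \<in> (\<lambda>x. 2 * t - 1 - x) ` T" if "z < s + 2 * t" for z
    using that st assms(4) by (force simp: S_def S_reps_def image_iff)
  have "complete_in (Zmod n) (S_set n s T) \<longleftrightarrow> (\<forall>z\<in>{0..<n} - S. z \<in> S <#>\<^bsub>Zmod n\<^esub> S)"
    using S_set_eq_S_reps[OF n st assms(4)] S_range st n \<open>0 < n\<close>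
    by (auto simp: complete_in_def Zmod_carrier S_def)
  also have "\<dots> \<longleftrightarrow> (\<forall>z\<in>{s - m..s + 2 * t - 1} - S. z \<in> S <#>\<^bsub>Zmod n\<^esub> S)"
  proof
    assume "\<forall>z\<in>{0..<n} - S. z \<in> S <#>\<^bsub>Zmod n\<^esub> S"
    moreover have "{s - m..s + 2 * t - 1} \<subseteq> {0..<n}"
      using m st n by auto
    ultimately show "\<forall>z\<in>{s - m..s + 2 * t - 1} - S. z \<in> S <#>\<^bsub>Zmod n\<^esub> S"
      by blast
  next
    assume border: "\<forall>z\<in>{s - m..s + 2 * t - 1} - S. z \<in> S <#>\<^bsub>Zmod n\<^esub> S"
    have low: "z \<in> S <#>\<^bsub>Zmod n\<^esub> S" if "0 \<le> z" "z < s + 2 * t" "z \<notin> S" for z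
      using that border small_residue_is_sum[OF n st \<open>m \<in> T\<close> m that(1)]
      by (cases "z < s - m") (auto simp: S_def)
    show "\<forall>z\<in>{0..<n} - S. z \<in> S <#>\<^bsub>Zmod n\<^esub> S"
    proof
      fix z assume z: "z \<in> {0..<n} - S"
      show "z \<in> S <#>\<^bsub>Zmod n\<^esub> S"
      proof (cases "z < s + 2 * t")
        case True
        then show ?thesis using low z by simp
      next
        case False
        have "2 * s \<le> z"
          using False z by (auto simp: S_def S_reps_def)
        have "n - z \<notin> S"
          using S_reps_reflect[OF n, of "n - z"] z by (auto simp: S_def)
        then have "n - z \<in> S <#>\<^bsub>Zmod n\<^esub> S"
          using low[of "n - z"] \<open>2 * s \<le> z\<close> z n by auto
        then show ?thesis
          using S_reps_sum_reflect[OF n \<open>0 < n\<close>] \<open>2 * s \<le> z\<close> z st by (auto simp: S_def)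
      qed
    qed
  qed
  also have "\<dots> \<longleftrightarrow> (\<forall>z\<in>{s - m..s + 2 * t - 1}.
      s + 2 * t - 1 - z \<notin> (\<lambda>x. 2 * t - 1 - x) ` T \<longrightarrow> s + 2 * t - 1 - z \<in> T + T)"
    using left border_residue_is_sum_iff[OF n st T m] by (auto simp: S_def)
  also have "\<dots> \<longleftrightarrow> (\<forall>w\<in>(\<lambda>z. s + 2 * t - 1 - z) ` {s - m..s + 2 * t - 1}.
      w \<notin> (\<lambda>x. 2 * t - 1 - x) ` T \<longrightarrow> w \<in> T + T)"
    by (simp only: ball_simps)
  also have "(\<lambda>z. s + 2 * t - 1 - z) ` {s - m..s + 2 * t - 1} = {0..2 * t - 1 + m}"
    by (simp add: image_diff_atLeastAtMost)
  finally show ?thesis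
    by (auto simp: m_def)
qed

end
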